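(* Let $\mathcal{R}$ be a commutative Frobenius ring of characteristic $2$, let $n\ge 1$, let $A$ and $B$ be $n\times n$ circulant matrices over $\mathcal{R}$, and let $C$ be an $n\times n$ reverse circulant matrix over $\mathcal{R}$. Suppose that $AA^{T}+BB^{T}+C^{2}=I_{n}$ and $AC=CA$. Then the code of length $4n$ over $\mathcal{R}$ generated by the rows of the $2n\times 4n$ matrix $$G=\left( I_{2n}\ \middle|\ \begin{array}{cc} A & B+C \\ B^{T}+C & A^{T}\end{array}\right)$$ is self-dual.
   Context: A code of length $N$ over $\mathcal{R}$ is an $\mathcal{R}$-submodule of $\mathcal{R}^N$; the code generated by a matrix is the $\mathcal{R}$-submodule spanned by its rows. Duality is with respect to the Euclidean inner product $\langle x,y\rangle=\sum_i x_iy_i$, and a code $\mathcal{C}$ is self-dual if $\mathcal{C}=\mathcal{C}^\perp$, where $\mathcal{C}^\perp=\{x\in\mathcal{R}^N:\langle x,y\rangle=0 \text{ for all } y\in\mathcal{C}\}$. An $n\times n$ matrix is circulant if each row is the right cyclic shift of the previous row, i.e. if its first row is $(a_1,\dots,a_n)$ then row $i+1$ is $\sigma^{i}(a_1,\dots,a_n)$ where $\sigma(a_1,\dots,a_n)=(a_n,a_1,\dots,a_{n-1})$. An $n\times n$ matrix is reverse circulant if each row is the left cyclic shift of the previous row, i.e. row $i+1$ is $\sigma^{-i}$ applied to the first row. *)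

theory Defs
  imports "Jordan_Normal_Form.VS_Connect" "HOL-Algebra.QuotRing"
begin

section \<open>Commutative Frobenius rings\<close>

definition artinian_ring :: "('a, 'b) ring_scheme \<Rightarrow> bool" where
  "artinian_ring R \<longleftrightarrow> ring R \<and>
     (\<forall>I :: nat \<Rightarrow> 'a set. (\<forall>k. ideal (I k) R \<and> I (Suc k) \<subseteq> I k) \<longrightarrow>
        (\<exists>m. \<forall>k\<ge>m. I k = I m))"

definition jacobson_radical :: "('a, 'b) ring_scheme \<Rightarrow> 'a set" where
  "jacobson_radical R = carrier R \<inter> \<Inter>{M. maximalideal M R}"

definition simple_ideal :: "('a, 'b) ring_scheme \<Rightarrow> 'a set \<Rightarrow> bool" where
  "simple_ideal R I \<longleftrightarrow> ideal I R \<and> I \<noteq> {\<zero>\<^bsub>R\<^esub>} \<and>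
     (\<forall>K. ideal K R \<and> K \<subseteq> I \<longrightarrow> K = {\<zero>\<^bsub>R\<^esub>} \<or> K = I)"

text \<open>For a commutative ring: the ideal generated by a family of ideals is their sum.\<close>

definition socle :: "('a, 'b) ring_scheme \<Rightarrow> 'a set" where
  "socle R = Idl\<^bsub>R\<^esub> (\<Union>{I. simple_ideal R I})"

definition ideal_module :: "('a, 'b) ring_scheme \<Rightarrow> 'a set \<Rightarrow> ('a, 'a) module" where
  "ideal_module R I =
     \<lparr>carrier = I, mult = mult R, one = \<one>\<^bsub>R\<^esub>, zero = \<zero>\<^bsub>R\<^esub>, add = add R,
      smult = mult R\<rparr>"

definition quotient_module :: "('a, 'b) ring_scheme \<Rightarrow> 'a set \<Rightarrow> ('a, 'a set) module" where
  "quotient_module R I =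
     \<lparr>carrier = carrier (R Quot I), mult = mult (R Quot I), one = \<one>\<^bsub>R Quot I\<^esub>,
      zero = \<zero>\<^bsub>R Quot I\<^esub>, add = add (R Quot I),
      smult = (\<lambda>r X. (I +>\<^bsub>R\<^esub> r) \<otimes>\<^bsub>R Quot I\<^esub> X)\<rparr>"

definition modules_isomorphic ::
  "('r, 'm) ring_scheme \<Rightarrow> ('r, 'a) module \<Rightarrow> ('r, 'c) module \<Rightarrow> bool" where
  "modules_isomorphic R M N \<longleftrightarrow>
     (\<exists>f \<in> LinearCombinations.module_hom R M N. bij_betw f (carrier M) (carrier N))"

text \<open>An Artinian ring \<open>R\<close> is Frobenius if \<open>R/J(R)\<close> and \<open>Soc(R)\<close> are isomorphic as left
  and as right \<open>R\<close>-modules; for commutative \<open>R\<close> this is one condition. Finite rings are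
  Artinian, so the finite Frobenius rings of coding theory are included.\<close>

definition comm_frobenius_ring :: "('a, 'b) ring_scheme \<Rightarrow> bool" where
  "comm_frobenius_ring R \<longleftrightarrow> cring R \<and> artinian_ring R \<and>
     modules_isomorphic R (quotient_module R (jacobson_radical R)) (ideal_module R (socle R))"


section \<open>Circulant and reverse circulant matrices\<close>

text \<open>The right cyclic shift \<open>(a\<^sub>1, \<dots>, a\<^sub>n) \<mapsto> (a\<^sub>n, a\<^sub>1, \<dots>, a\<^sub>n\<^sub>-\<^sub>1)\<close> and its inverse, the left
  cyclic shift; vectors and matrices are indexed from \<open>0\<close>.\<close>

definition right_shift :: "'a vec \<Rightarrow> 'a vec" where
  "right_shift v = vec (dim_vec v) (\<lambda>j. if j = 0 then v $ (dim_vec v - 1) else v $ (j - 1))"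

definition left_shift :: "'a vec \<Rightarrow> 'a vec" where
  "left_shift v = vec (dim_vec v) (\<lambda>j. if Suc j = dim_vec v then v $ 0 else v $ Suc j)"

definition circulant_mat :: "nat \<Rightarrow> 'a mat \<Rightarrow> bool" where
  "circulant_mat n A \<longleftrightarrow> A \<in> carrier_mat n n \<and>
     (\<forall>i. Suc i < n \<longrightarrow> row A (Suc i) = right_shift (row A i))"

definition reverse_circulant_mat :: "nat \<Rightarrow> 'a mat \<Rightarrow> bool" where
  "reverse_circulant_mat n A \<longleftrightarrow> A \<in> carrier_mat n n \<and>
     (\<forall>i. Suc i < n \<longrightarrow> row A (Suc i) = left_shift (row A i))"


section \<open>Codes over a commutative ring\<close>

definition generated_code :: "'a::comm_ring_1 mat \<Rightarrow> 'a vec set" where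
  "generated_code G =
     LinearCombinations.module.span class_ring (module_vec TYPE('a) (dim_col G)) (set (rows G))"

definition dual_code :: "nat \<Rightarrow> 'a::comm_ring_1 vec set \<Rightarrow> 'a vec set" where
  "dual_code N C = {x \<in> carrier_vec N. \<forall>y\<in>C. x \<bullet> y = 0}"

definition linear_code :: "nat \<Rightarrow> 'a::comm_ring_1 vec set \<Rightarrow> bool" where
  "linear_code N C \<longleftrightarrow> Module.submodule C class_ring (module_vec TYPE('a) N)"

definition self_dual_code :: "nat \<Rightarrow> 'a::comm_ring_1 vec set \<Rightarrow> bool" where
  "self_dual_code N C \<longleftrightarrow> linear_code N C \<and> C = dual_code N C"

definition append_cols :: "'a::zero mat \<Rightarrow> 'a mat \<Rightarrow> 'a mat" where
  "append_cols X Y = four_block_mat X Y (0\<^sub>m 0 (dim_col X)) (0\<^sub>m 0 (dim_col Y))"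

end

theory Submission
  imports Defs
begin

text \<open>Write \<open>M\<close> for the right half of \<open>G\<close>. In characteristic 2 the code generated by \<open>(I | M)\<close> is
  self-dual as soon as \<open>M M\<^sup>T = M\<^sup>T M = I\<close>. A reverse circulant \<open>C\<close> is symmetric and satisfies
  \<open>B C = C B\<^sup>T\<close> for every circulant \<open>B\<close>, while circulants commute with each other, so in the block
  product \<open>M M\<^sup>T\<close> all mixed terms occur in equal pairs and cancel. Finally \<open>M\<^sup>T\<close> is again of
  the same shape, with \<open>A\<^sup>T\<close> in place of \<open>A\<close>, which yields \<open>M\<^sup>T M = I\<close>.\<close>

section \<open>Circulant and reverse circulant matrices\<close>

text \<open>Each right shift adds one to the row and to the column of an entry, so column minus row
  is constant modulo \<open>n\<close>. The difference can be negative, so the residue is taken in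
  \<open>int\<close> and only then cast to \<open>nat\<close>. The column stays arbitrary in the
  induction because passing to the previous row changes it.\<close>

lemma circulant_mat_index:
  assumes "circulant_mat n A" "i < n" "j < n"
  shows "A $$ (i, j) = A $$ (0, nat ((int j - int i) mod int n))"
  using assms(2,3)
proof (induction i arbitrary: j)
  case 0
  then show ?case by (simp add: nat_mod_as_int[symmetric])
next
  case (Suc i)
  have A: "A \<in> carrier_mat n n" and r: "row A (Suc i) = right_shift (row A i)"
    using assms(1) Suc.prems by (auto simp: circulant_mat_def)
  define j' where "j' = (if j = 0 then n - 1 else j - 1)"
  have j': "j' < n" using Suc.prems by (auto simp: j'_def)
  have "A $$ (Suc i, j) = row A (Suc i) $ j"
    using A Suc.prems by simp
  also have "\<dots> = A $$ (i, j')"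
    unfolding r using A Suc.prems j' by (auto simp: right_shift_def j'_def)
  also have "\<dots> = A $$ (0, nat ((int j' - int i) mod int n))"
    using Suc.IH[OF _ j'] Suc.prems by simp
  \<comment> \<open>The column read by the shift is \<open>j'\<close>. At \<open>j = 0\<close> it
    wraps around to \<open>n - 1\<close>, and the two differences agree only up to adding
    \<open>n\<close>; otherwise they are equal.\<close>
  also have "(int j' - int i) mod int n = (int j - int (Suc i)) mod int n"
  proof (cases "j = 0")
    case True
    then have "int j' - int i = int j - int (Suc i) + int n"
      using Suc.prems by (simp add: j'_def of_nat_diff)
    then show ?thesis by (simp only: mod_add_self2)
  next
    case False
    then have "int j' - int i = int j - int (Suc i)"
      by (simp add: j'_def of_nat_diff)
    then show ?thesis by (simp only:)
  qed
  finally show ?case .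
qed

text \<open>Same induction for the left shift, where the invariant is row plus column. Sums are
  never negative, so \<open>mod\<close> on \<open>nat\<close> suffices.\<close>

lemma reverse_circulant_mat_index:
  assumes "reverse_circulant_mat n C" "i < n" "j < n"
  shows "C $$ (i, j) = C $$ (0, (i + j) mod n)"
  using assms(2,3)
proof (induction i arbitrary: j)
  case 0
  then show ?case by simp
next
  case (Suc i)
  have C: "C \<in> carrier_mat n n" and r: "row C (Suc i) = left_shift (row C i)"
    using assms(1) Suc.prems by (auto simp: reverse_circulant_mat_def)
  define j' where "j' = (if Suc j = n then 0 else Suc j)"
  have j': "j' < n" using Suc.prems by (auto simp: j'_def)
  have "C $$ (Suc i, j) = row C (Suc i) $ j"
    using C Suc.prems by simp
  also have "\<dots> = C $$ (i, j')"
    unfolding r using C Suc.prems j' by (auto simp: left_shift_def j'_def)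
  also have "\<dots> = C $$ (0, (i + j') mod n)"
    using Suc.IH[OF _ j'] Suc.prems by simp
  also have "(i + j') mod n = (Suc i + j) mod n"
  proof (cases "Suc j = n")
    case True
    then have "Suc i + j = i + n" by simp
    then show ?thesis by (simp only: j'_def True simp_thms if_True add_0_right mod_add_self2)
  next
    case False
    then show ?thesis by (simp add: j'_def)
  qed
  finally show ?case .
qed

lemma circulant_mat_cong:
  assumes "circulant_mat n A" "i < n" "j < n" "i' < n" "j' < n"
    and "(int j - int i) mod int n = (int j' - int i') mod int n"
  shows "A $$ (i, j) = A $$ (i', j')"
  by (simp only: circulant_mat_index[OF assms(1-3)] circulant_mat_index[OF assms(1,4,5)] assms(6))

lemma reverse_circulant_mat_cong:
  assumes "reverse_circulant_mat n C" "i < n" "j < n" "i' < n" "j' < n"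
    and "(int i + int j) mod int n = (int i' + int j') mod int n"
  shows "C $$ (i, j) = C $$ (i', j')"
proof -
  have "(i + j) mod n = (i' + j') mod n"
    using assms(6) by (metis of_nat_add of_nat_eq_iff of_nat_mod)
  then show ?thesis
    by (simp only: reverse_circulant_mat_index[OF assms(1-3)]
        reverse_circulant_mat_index[OF assms(1,4,5)])
qed

lemma reverse_circulant_mat_transpose:
  assumes "reverse_circulant_mat n C"
  shows "C\<^sup>T = C"
proof -
  have "C \<in> carrier_mat n n" using assms by (simp add: reverse_circulant_mat_def)
  then show ?thesis
    by (intro eq_matI) (auto intro: reverse_circulant_mat_cong[OF assms] simp: add.commute)
qed

text \<open>A cyclic step along the diagonal, from \<open>(j', i)\<close> to
  \<open>(j, Suc i)\<close>, keeps the index difference modulo \<open>n\<close>. Read in the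
  transpose, this is the shift condition between consecutive rows.\<close>

lemma circulant_mat_transpose:
  assumes "circulant_mat n A"
  shows "circulant_mat n A\<^sup>T"
proof -
  have A: "A \<in> carrier_mat n n" using assms by (simp add: circulant_mat_def)
  have "row A\<^sup>T (Suc i) = right_shift (row A\<^sup>T i)" if i: "Suc i < n" for i
  proof (rule eq_vecI)
    show "dim_vec (row A\<^sup>T (Suc i)) = dim_vec (right_shift (row A\<^sup>T i))"
      using A by (simp add: right_shift_def)
    fix j assume "j < dim_vec (right_shift (row A\<^sup>T i))"
    then have j: "j < n" using A by (simp add: right_shift_def)
    define j' where "j' = (if j = 0 then n - 1 else j - 1)"
    have j': "j' < n" using j by (auto simp: j'_def)
    have "(int (Suc i) - int j) mod int n = (int i - int j') mod int n"
    proof (cases "j = 0")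
      case True
      then have "int (Suc i) - int j = int i - int j' + int n"
        using i by (simp add: j'_def of_nat_diff)
      then show ?thesis by (simp only: mod_add_self2)
    next
      case False
      then show ?thesis by (simp add: j'_def of_nat_diff algebra_simps)
    qed
    then have "A $$ (j, Suc i) = A $$ (j', i)"
      using i j j' by (intro circulant_mat_cong[OF assms]) auto
    then show "row A\<^sup>T (Suc i) $ j = right_shift (row A\<^sup>T i) $ j"
      using A i j j' by (auto simp: right_shift_def j'_def)
  qed
  with A show ?thesis by (simp add: circulant_mat_def)
qed

section \<open>Matrix products compared by permuting the summation index modulo
  \<open>n\<close>\<close>

lemma bij_betw_reflect_mod:
  assumes "0 < n"
  shows "bij_betw (\<lambda>k. nat ((c - int k) mod int n)) {0..<n} {0..<n}"
  using assms
  by (intro bij_betw_byWitness[where f' = "\<lambda>k. nat ((c - int k) mod int n)"])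
    (auto simp: mod_diff_right_eq nat_less_iff)

lemma bij_betw_shift_mod:
  assumes "0 < n"
  shows "bij_betw (\<lambda>k. nat ((int k + c) mod int n)) {0..<n} {0..<n}"
  using assms
  by (intro bij_betw_byWitness[where f' = "\<lambda>k. nat ((int k - c) mod int n)"])
    (auto simp: mod_diff_left_eq mod_add_left_eq nat_less_iff)

text \<open>Both entries are sums over \<open>k\<close>; they agree once a permutation of the index,
  which may depend on the position \<open>(i, j)\<close>, matches the summands one by one.\<close>

lemma mat_mult_eqI_reindex:
  assumes "A \<in> carrier_mat n n" "B \<in> carrier_mat n n" "P \<in> carrier_mat n n" "Q \<in> carrier_mat n n"
    and "\<And>i j. i < n \<Longrightarrow> j < n \<Longrightarrow> bij_betw (\<pi> i j) {0..<n} {0..<n}"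
    and "\<And>i j k. i < n \<Longrightarrow> j < n \<Longrightarrow> k < n \<Longrightarrow>
           A $$ (i, k) * B $$ (k, j) = P $$ (i, \<pi> i j k) * Q $$ (\<pi> i j k, j)"
  shows "A * B = P * Q"
proof (rule eq_matI)
  fix i j assume "i < dim_row (P * Q)" "j < dim_col (P * Q)"
  then have ij: "i < n" "j < n" using assms by auto
  have "(A * B) $$ (i, j) = (\<Sum>k\<in>{0..<n}. A $$ (i, k) * B $$ (k, j))"
    using assms ij by (simp add: scalar_prod_def)
  also have "\<dots> = (\<Sum>k\<in>{0..<n}. P $$ (i, \<pi> i j k) * Q $$ (\<pi> i j k, j))"
    using assms(6) ij by (intro sum.cong) auto
  also have "\<dots> = (\<Sum>k\<in>{0..<n}. P $$ (i, k) * Q $$ (k, j))"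
    by (rule sum.reindex_bij_betw[OF assms(5)[OF ij]])
  also have "\<dots> = (P * Q) $$ (i, j)"
    using assms ij by (simp add: scalar_prod_def)
  finally show "(A * B) $$ (i, j) = (P * Q) $$ (i, j)" .
qed (use assms in auto)

lemma circulant_mat_commute:
  fixes A B :: "'a::comm_semiring_0 mat"
  assumes A: "circulant_mat n A" and B: "circulant_mat n B"
  shows "A * B = B * A"
\<comment> \<open>With \<open>l = i + j - k\<close> modulo \<open>n\<close> one has
  \<open>k - i = j - l\<close> and \<open>j - k = l - i\<close>, so both factors keep their index
  differences.\<close>
proof (rule mat_mult_eqI_reindex[where n = n
      and \<pi> = "\<lambda>i j k. nat ((int i + int j - int k) mod int n)"])
  fix i j k assume ijk: "i < n" "j < n" "k < n"
  let ?l = "nat ((int i + int j - int k) mod int n)"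
  have l: "int ?l = (int i + int j - int k) mod int n" "?l < n"
    using ijk by (auto simp: nat_less_iff)
  have "A $$ (i, k) = A $$ (?l, j)"
    using ijk l by (intro circulant_mat_cong[OF A]) (simp_all add: mod_diff_right_eq)
  moreover have "B $$ (k, j) = B $$ (i, ?l)"
    using ijk l by (intro circulant_mat_cong[OF B]) (simp_all add: mod_diff_left_eq)
  ultimately show "A $$ (i, k) * B $$ (k, j) = B $$ (i, ?l) * A $$ (?l, j)"
    by (simp add: mult.commute)
qed (use A B bij_betw_reflect_mod in \<open>auto simp: circulant_mat_def\<close>)

lemma circulant_mat_mult_reverse_circulant:
  fixes B C :: "'a::comm_semiring_0 mat"
  assumes B: "circulant_mat n B" and C: "reverse_circulant_mat n C"
  shows "B * C = C * B\<^sup>T"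
\<comment> \<open>With \<open>l = k + j - i\<close> modulo \<open>n\<close> one has
  \<open>k - i = l - j\<close>, the difference for \<open>B\<close>, and
  \<open>k + j = i + l\<close>, the sum for \<open>C\<close>.\<close>
proof (rule mat_mult_eqI_reindex[where n = n
      and \<pi> = "\<lambda>i j k. nat ((int k + (int j - int i)) mod int n)"])
  fix i j k assume ijk: "i < n" "j < n" "k < n"
  let ?l = "nat ((int k + (int j - int i)) mod int n)"
  have l: "int ?l = (int k + (int j - int i)) mod int n" "?l < n"
    using ijk by (auto simp: nat_less_iff)
  have "B $$ (i, k) = B $$ (j, ?l)"
    using ijk l by (intro circulant_mat_cong[OF B]) (simp_all add: mod_diff_left_eq)
  moreover have "C $$ (k, j) = C $$ (i, ?l)"
    using ijk l by (intro reverse_circulant_mat_cong[OF C]) (simp_all add: mod_add_right_eq)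
  moreover have "B\<^sup>T $$ (?l, j) = B $$ (j, ?l)"
    using ijk l B by (auto simp: circulant_mat_def)
  ultimately show "B $$ (i, k) * C $$ (k, j) = C $$ (i, ?l) * B\<^sup>T $$ (?l, j)"
    by (simp add: mult.commute)
qed (use B C bij_betw_shift_mod in \<open>auto simp: circulant_mat_def reverse_circulant_mat_def\<close>)

section \<open>Codes generated by \<open>(I | M)\<close>\<close>

text \<open>Reduces the submodule axioms to elementary closure conditions; closure under negation
  comes from scaling by \<open>- 1\<close>.\<close>

lemma linear_code_iff:
  fixes D :: "'a::comm_ring_1 vec set"
  shows "linear_code N D \<longleftrightarrow> D \<subseteq> carrier_vec N \<and> 0\<^sub>v N \<in> D \<and>
    (\<forall>x\<in>D. \<forall>y\<in>D. x + y \<in> D) \<and> (\<forall>c. \<forall>x\<in>D. c \<cdot>\<^sub>v x \<in> D)" (is "_ \<longleftrightarrow> ?closed")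
proof -
  interpret vec_module "TYPE('a)" N .
  show ?thesis
  proof
    assume "linear_code N D"
    then interpret D: Module.submodule D class_ring V by (simp add: linear_code_def)
    show ?closed
      using D.subset D.one_closed D.m_closed D.smult_closed
      by (auto simp: module_vec_simps class_ring_simps)
  next
    assume D: ?closed
    have "\<ominus>\<^bsub>V\<^esub> x \<in> D" if "x \<in> D" for x
    proof -
      have "x \<in> carrier_vec N" using D that by auto
      then have "\<ominus>\<^bsub>V\<^esub> x = (- 1) \<cdot>\<^sub>v x" using smult_minus_1[of x] by simp
      with D that show ?thesis by metis
    qed
    with D show "linear_code N D"
      unfolding linear_code_def
      by (intro submoduleI) (auto simp: module_vec_simps class_ring_simps)
  qed
qed

text \<open>Links the submodule notion in \<open>linear_code\<close> with the one in which the facts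
  about spans are stated.\<close>

lemma linear_code_iff_submodule:
  fixes D :: "'a::comm_ring_1 vec set"
  shows "linear_code N D \<longleftrightarrow> LinearCombinations.submodule class_ring D (module_vec TYPE('a) N)"
proof -
  interpret vec_module "TYPE('a)" N .
  show ?thesis
    unfolding linear_code_iff LinearCombinations.submodule_def
    using module_axioms by (auto simp: module_vec_simps class_ring_simps)
qed

lemma linear_code_dual_code:
  fixes S :: "'a::comm_ring_1 vec set"
  assumes "S \<subseteq> carrier_vec N"
  shows "linear_code N (dual_code N S)"
  using assms
  by (auto simp: linear_code_iff dual_code_def add_scalar_prod_distrib[of _ N] subset_iff)

lemma generated_code_least:
  fixes G :: "'a::comm_ring_1 mat"
  assumes "linear_code (dim_col G) D" "set (rows G) \<subseteq> D"
  shows "generated_code G \<subseteq> D"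
proof -
  interpret vec_module "TYPE('a)" "dim_col G" .
  show ?thesis
    using span_is_subset[OF assms(2)] assms(1)
    by (simp add: generated_code_def linear_code_iff_submodule)
qed

lemma linear_code_generated_code:
  fixes G :: "'a::comm_ring_1 mat"
  shows "linear_code (dim_col G) (generated_code G)"
proof -
  interpret vec_module "TYPE('a)" "dim_col G" .
  show ?thesis
    unfolding linear_code_iff_submodule generated_code_def
    by (rule span_is_submodule) (rule rows_carrier)
qed

text \<open>The product is the linear combination of the rows of \<open>G\<close> with coefficients
  \<open>w\<close>.\<close>

lemma transpose_mult_vec_in_generated_code:
  fixes G :: "'a::comm_ring_1 mat"
  assumes "w \<in> carrier_vec (dim_row G)"
  shows "G\<^sup>T *\<^sub>v w \<in> generated_code G"
proof -
  interpret vec_module "TYPE('a)" "dim_col G" .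
  have "G\<^sup>T = mat_of_cols (dim_col G) (rows G)"
    by (metis cols_transpose index_transpose_mat(2) mat_of_cols_cols)
  then show ?thesis
    unfolding generated_code_def
    using mat_of_cols_mult_as_finsum[of w "rows G"] assms
    by (auto simp: span_def)
qed

text \<open>Orthogonality of the rows is extended to the span one argument at a time. The dual of
  the set of rows is a code containing the rows, hence the whole span; by symmetry of the inner
  product the rows then lie in the dual of the span, which is again a code.\<close>

lemma generated_code_subset_dual_code:
  fixes G :: "'a::comm_ring_1 mat"
  assumes "G * G\<^sup>T = 0\<^sub>m (dim_row G) (dim_row G)"
  shows "generated_code G \<subseteq> dual_code (dim_col G) (generated_code G)"
proof -
  let ?N = "dim_col G"
  have gen: "generated_code G \<subseteq> dual_code ?N S"
    if "S \<subseteq> carrier_vec ?N" "set (rows G) \<subseteq> dual_code ?N S" for S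
    by (rule generated_code_least[OF linear_code_dual_code[OF that(1)] that(2)])
  have rows: "set (rows G) \<subseteq> carrier_vec ?N" by (rule rows_carrier)
  have "row G i \<bullet> row G j = 0" if "i < dim_row G" "j < dim_row G" for i j
  proof -
    have "row G i \<bullet> row G j = (G * G\<^sup>T) $$ (i, j)" using that by simp
    also have "\<dots> = 0" using that by (simp only: assms index_zero_mat)
    finally show ?thesis .
  qed
  then have "set (rows G) \<subseteq> dual_code ?N (set (rows G))"
    using rows by (auto simp: dual_code_def rows_def)
  from gen[OF rows this] have sub: "generated_code G \<subseteq> dual_code ?N (set (rows G))" .
  then have "generated_code G \<subseteq> carrier_vec ?N" by (auto simp: dual_code_def)
  moreover have "set (rows G) \<subseteq> dual_code ?N (generated_code G)"
  proof
    fix r assume r: "r \<in> set (rows G)"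
    then have rc: "r \<in> carrier_vec ?N" using rows by blast
    have "r \<bullet> y = 0" if "y \<in> generated_code G" for y
    proof -
      have "y \<in> carrier_vec ?N" "y \<bullet> r = 0" using that sub r by (auto simp: dual_code_def)
      then show ?thesis using comm_scalar_prod[OF rc] by simp
    qed
    with rc show "r \<in> dual_code ?N (generated_code G)" by (simp add: dual_code_def)
  qed
  ultimately show ?thesis by (rule gen)
qed

lemma add_self_CHAR_2:
  assumes "CHAR('a::ring_1) = 2"
  shows "(x::'a) + x = 0"
  using minus_CHAR_2[OF assms, of x x] by simp

text \<open>\<open>M * M\<^sup>T = 1\<^sub>m m\<close> makes the code self-orthogonal, since the
  Gram matrix of the rows is twice the identity. \<open>M\<^sup>T * M = 1\<^sub>m m\<close> gives
  the reverse inclusion by showing that a dual vector \<open>(u, v)\<close> is the codeword with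
  coefficients \<open>u\<close>. No count of codewords enters, so the ring may be infinite.\<close>

lemma self_dual_code_append_one:
  fixes M :: "'a::comm_ring_1 mat"
  assumes char: "CHAR('a) = 2" and M: "M \<in> carrier_mat m m"
    and MMt: "M * M\<^sup>T = 1\<^sub>m m" and MtM: "M\<^sup>T * M = 1\<^sub>m m"
  shows "self_dual_code (m + m) (generated_code (append_cols (1\<^sub>m m) M))"
proof -
  let ?G = "append_cols (1\<^sub>m m) M"
  have G: "?G = four_block_mat (1\<^sub>m m) M (0\<^sub>m 0 m) (0\<^sub>m 0 m)"
    using M by (simp add: append_cols_def)
  have dim: "dim_row ?G = m" "dim_col ?G = m + m"
    using M by (simp_all add: G)
  have Gt: "?G\<^sup>T = four_block_mat (1\<^sub>m m) (0\<^sub>m m 0) M\<^sup>T (0\<^sub>m m 0)"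
    unfolding G by (subst transpose_four_block_mat[of _ m m _ m _ 0]) (use M in auto)
  have z: "1\<^sub>m m + 1\<^sub>m m = (0\<^sub>m m m :: 'a mat)"
    by (rule eq_matI) (auto simp: add_self_CHAR_2[OF char])
  have "?G * ?G\<^sup>T = four_block_mat (1\<^sub>m m + M * M\<^sup>T) (0\<^sub>m m 0) (0\<^sub>m 0 m) (0\<^sub>m 0 0)"
    unfolding Gt unfolding G
    by (subst mult_four_block_mat[of _ m m _ m _ 0 _ _ m _ 0]) (use M in auto)
  also have "\<dots> = 0\<^sub>m m m"
    by (simp add: MMt z)
  finally have "?G * ?G\<^sup>T = 0\<^sub>m (dim_row ?G) (dim_row ?G)" by (simp only: dim)
  from generated_code_subset_dual_code[OF this]
  have sub: "generated_code ?G \<subseteq> dual_code (m + m) (generated_code ?G)" by (simp only: dim)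
  have "x \<in> generated_code ?G" if x: "x \<in> dual_code (m + m) (generated_code ?G)" for x
  proof -
    define u v where "u = vec_first x m" and "v = vec_last x m"
    have uv: "u \<in> carrier_vec m" "v \<in> carrier_vec m" and xuv: "x = u @\<^sub>v v"
      using x by (auto simp: u_def v_def dual_code_def)
    have orth: "(?G\<^sup>T *\<^sub>v w) \<bullet> x = 0" if "w \<in> carrier_vec m" for w
    proof -
      have "?G\<^sup>T *\<^sub>v w \<in> generated_code ?G"
        using transpose_mult_vec_in_generated_code[of w ?G] that dim by simp
      moreover from this have "?G\<^sup>T *\<^sub>v w \<in> carrier_vec (m + m)"
        using sub by (auto simp: dual_code_def)
      ultimately show ?thesis
        using x comm_scalar_prod[of x "m + m" "?G\<^sup>T *\<^sub>v w"]
        by (simp add: dual_code_def)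
    qed
    \<comment> \<open>The transpose of the generator matrix has an empty second block column, so the
      vector is split as \<open>w\<close> followed by \<open>vNil\<close> to fit the blocks.\<close>
    have mult: "?G\<^sup>T *\<^sub>v w = w @\<^sub>v (M\<^sup>T *\<^sub>v w)" if w: "w \<in> carrier_vec m" for w
    proof -
      have "?G\<^sup>T *\<^sub>v (w @\<^sub>v vNil) = w @\<^sub>v (M\<^sup>T *\<^sub>v w)"
        unfolding Gt by (subst four_block_mat_mult_vec[of _ m m _ 0 _ m]) (use M w in auto)
      moreover have "w @\<^sub>v vNil = w" by (rule eq_vecI) auto
      ultimately show ?thesis by simp
    qed
    have "u = M *\<^sub>v v"
    proof (rule eq_vecI)
      fix i assume "i < dim_vec (M *\<^sub>v v)"
      then have i: "i < m" using M by simp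
      have "M\<^sup>T *\<^sub>v unit_vec m i = row M i"
        using M i by (intro eq_vecI) simp_all
      then have "0 = (unit_vec m i @\<^sub>v row M i) \<bullet> (u @\<^sub>v v)"
        using orth[of "unit_vec m i"] mult[of "unit_vec m i"] xuv by simp
      also have "\<dots> = unit_vec m i \<bullet> u + row M i \<bullet> v"
        using M uv i by (intro scalar_prod_append) auto
      also have "\<dots> = u $ i + (M *\<^sub>v v) $ i" using M uv i by simp
      finally show "u $ i = (M *\<^sub>v v) $ i"
        using uminus_CHAR_2[OF char] by (metis eq_neg_iff_add_eq_0)
    qed (use M uv in auto)
    then have "M\<^sup>T *\<^sub>v u = v"
      using M uv MtM by (simp flip: assoc_mult_mat_vec[of _ m m _ m])
    then have "x = ?G\<^sup>T *\<^sub>v u" using mult[OF uv(1)] xuv by simp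
    then show ?thesis
      using transpose_mult_vec_in_generated_code[of u ?G] uv dim by simp
  qed
  with sub linear_code_generated_code[of ?G] show ?thesis
    unfolding self_dual_code_def dim by blast
qed

section \<open>The block matrix\<close>

text \<open>The second factor is the transpose of the first, written out in blocks. In this form,
  replacing \<open>A\<close> by \<open>A\<^sup>T\<close> swaps the two factors, so one computation
  serves both products.\<close>

lemma block_mat_mult_transpose:
  fixes A B C :: "'a::comm_ring_1 mat"
  assumes char: "CHAR('a) = 2"
    and A: "circulant_mat n A" and B: "circulant_mat n B" and C: "reverse_circulant_mat n C"
    and sum: "A * A\<^sup>T + B * B\<^sup>T + C ^\<^sub>m 2 = 1\<^sub>m n" and AC: "A * C = C * A"
  shows "four_block_mat A (B + C) (B\<^sup>T + C) A\<^sup>T * four_block_mat A\<^sup>T (B + C) (B\<^sup>T + C) A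
           = 1\<^sub>m (n + n)"
proof -
  have [simp]: "A \<in> carrier_mat n n" "B \<in> carrier_mat n n" "C \<in> carrier_mat n n"
    using A B C by (auto simp: circulant_mat_def reverse_circulant_mat_def)
  note Ct = reverse_circulant_mat_transpose[OF C]
  have C2: "C ^\<^sub>m 2 = C * C" by (simp add: numeral_2_eq_2)
  note distrib = add_mult_distrib_mat[of _ n n _ _ n] mult_add_distrib_mat[of _ n n _ n]
  \<comment> \<open>The bracketing is that of an expanded product of two binomials whose two mixed
    terms have become the same matrix \<open>S\<close>.\<close>
  have cancel: "P + (Q + S + (S + R)) = P + Q + R"
    if "P \<in> carrier_mat n n" "Q \<in> carrier_mat n n" "R \<in> carrier_mat n n" "S \<in> carrier_mat n n"
    for P Q R S :: "'a mat"
  proof (rule eq_matI)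
    fix i j assume "i < dim_row (P + Q + R)" "j < dim_col (P + Q + R)"
    then have ij: "i < n" "j < n" using that by auto
    have "p + (q + s + (s + r)) = p + q + r + (s + s)" for p q r s :: 'a
      by (simp add: algebra_simps)
    then show "(P + (Q + S + (S + R))) $$ (i, j) = (P + Q + R) $$ (i, j)"
      using that ij by (simp add: add_self_CHAR_2[OF char])
  qed (use that in auto)
  have cancel0: "X + X = 0\<^sub>m n n" if "X \<in> carrier_mat n n" for X :: "'a mat"
    using that by (intro eq_matI) (auto simp: add_self_CHAR_2[OF char])
  have BC: "B * C = C * B\<^sup>T"
    by (rule circulant_mat_mult_reverse_circulant[OF B C])
  have BtC: "B\<^sup>T * C = C * B"
    using circulant_mat_mult_reverse_circulant[OF circulant_mat_transpose[OF B] C] by simp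
  \<comment> \<open>Transposing \<open>A * C = C * A\<close> gives this because \<open>C\<close> is
    symmetric.\<close>
  have AtC: "C * A\<^sup>T = A\<^sup>T * C"
    using arg_cong[OF AC, of transpose_mat] by (simp add: transpose_mult[of _ n n _ n] Ct)
  note AB = circulant_mat_commute[OF A B]
  note AtBt = circulant_mat_commute[OF circulant_mat_transpose[OF A] circulant_mat_transpose[OF B]]
  note AAt = circulant_mat_commute[OF A circulant_mat_transpose[OF A]]
  note BBt = circulant_mat_commute[OF B circulant_mat_transpose[OF B]]
  \<comment> \<open>The mixed terms are \<open>B * C\<close> and \<open>C * B\<^sup>T\<close>, which
    coincide by \<open>BC\<close>.\<close>
  have "A * A\<^sup>T + (B + C) * (B\<^sup>T + C) = A * A\<^sup>T + (B * B\<^sup>T + B * C + (B * C + C * C))"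
    by (simp add: distrib BC)
  also have "\<dots> = 1\<^sub>m n"
    using sum C2 by (subst cancel) (simp_all add: mult_carrier_mat[of _ n n _ n])
  finally have 1: "A * A\<^sup>T + (B + C) * (B\<^sup>T + C) = 1\<^sub>m n" .
  have 2: "A * (B + C) + (B + C) * A = 0\<^sub>m n n"
    by (simp add: distrib AB AC cancel0 mult_carrier_mat[of _ n n _ n])
  have 3: "(B\<^sup>T + C) * A\<^sup>T + A\<^sup>T * (B\<^sup>T + C) = 0\<^sub>m n n"
    by (simp add: distrib AtBt AtC cancel0 mult_carrier_mat[of _ n n _ n])
  have "(B\<^sup>T + C) * (B + C) + A\<^sup>T * A = A\<^sup>T * A + (B\<^sup>T + C) * (B + C)"
    by (rule comm_add_mat[of _ n n]) (simp_all add: mult_carrier_mat[of _ n n _ n])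
  \<comment> \<open>Here the mixed terms are \<open>B\<^sup>T * C\<close> and \<open>C * B\<close>,
    equal by \<open>BtC\<close>; commuting each circulant with its transpose restores the form of
    the hypothesis \<open>sum\<close>.\<close>
  also have "\<dots> = A * A\<^sup>T + (B * B\<^sup>T + C * B + (C * B + C * C))"
    by (simp add: distrib BtC AAt BBt)
  also have "\<dots> = 1\<^sub>m n"
    using sum C2 by (subst cancel) (simp_all add: mult_carrier_mat[of _ n n _ n])
  finally have 4: "(B\<^sup>T + C) * (B + C) + A\<^sup>T * A = 1\<^sub>m n" .
  show ?thesis
    by (subst mult_four_block_mat[of _ n n _ n _ n _ _ n _ n]) (simp_all add: 1 2 3 4)
qed

theorem theorem3p1:
  fixes A B C :: "'r::comm_ring_1 mat" and n :: nat
  assumes "comm_frobenius_ring (class_ring :: 'r ring)"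
    and "CHAR('r) = 2"
    and "n \<ge> 1"
    and "circulant_mat n A" and "circulant_mat n B"
    and "reverse_circulant_mat n C"
    and "A * A\<^sup>T + B * B\<^sup>T + C ^\<^sub>m 2 = 1\<^sub>m n"
    and "A * C = C * A"
  shows "self_dual_code (4 * n)
    (generated_code
      (append_cols (1\<^sub>m (2 * n)) (four_block_mat A (B + C) (B\<^sup>T + C) A\<^sup>T)))"
proof -
  let ?M = "four_block_mat A (B + C) (B\<^sup>T + C) A\<^sup>T"
  have [simp]: "A \<in> carrier_mat n n" "B \<in> carrier_mat n n" "C \<in> carrier_mat n n"
    using assms(4-6) by (auto simp: circulant_mat_def reverse_circulant_mat_def)
  note Ct = reverse_circulant_mat_transpose[OF assms(6)]
  have Mt: "?M\<^sup>T = four_block_mat A\<^sup>T (B + C) (B\<^sup>T + C) A"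
    by (subst transpose_four_block_mat[of _ n n _ n _ n]) (simp_all add: transpose_add[of _ n n] Ct)
  have AtC: "A\<^sup>T * C = C * A\<^sup>T"
    using arg_cong[OF assms(8), of transpose_mat] by (simp add: transpose_mult[of _ n n _ n] Ct)
  \<comment> \<open>Together with \<open>AtC\<close> this shows that the hypotheses on
    \<open>A\<close> are stable under transposition, as the second product needs.\<close>
  have sum': "A\<^sup>T * A\<^sup>T\<^sup>T + B * B\<^sup>T + C ^\<^sub>m 2 = 1\<^sub>m n"
    using assms(7) circulant_mat_commute[OF assms(4) circulant_mat_transpose[OF assms(4)]] by simp
  have "?M * ?M\<^sup>T = 1\<^sub>m (n + n)"
    unfolding Mt by (rule block_mat_mult_transpose[OF assms(2,4-8)])
  moreover have "?M\<^sup>T * ?M = 1\<^sub>m (n + n)"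
    unfolding Mt
    using block_mat_mult_transpose[OF assms(2) circulant_mat_transpose[OF assms(4)] assms(5,6)
        sum' AtC] by simp
  moreover have "?M \<in> carrier_mat (n + n) (n + n)" by simp
  ultimately have "self_dual_code ((n + n) + (n + n))
      (generated_code (append_cols (1\<^sub>m (n + n)) ?M))"
    using self_dual_code_append_one[OF assms(2)] by blast
  moreover have "2 * n = n + n" "4 * n = (n + n) + (n + n)" by simp_all
  ultimately show ?thesis by (simp only:)
qed

end
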